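(* Let $X$ and $Y$ be compact Hausdorff spaces, let $\mathcal{A} \subset C(X,I)$ and $\mathcal{B} \subset C(Y,I)$ be semigroups (under pointwise multiplication) each satisfying Properties 1, 2 and 3, and let $\varphi: \mathcal{A} \to \mathcal{B}$ be multiplicative and bijective. Let $\mathcal{R}(\varphi) \subset Y$ be the set of standard points for $\varphi$. Then: (1) there exist a homeomorphism $\mu$ from $Y$ onto $X$ and a continuous map $p: \mathcal{R}(\varphi) \to (0,+\infty)$ such that $$\varphi(f)(y) = f(\mu(y))^{p(y)}$$ for every $f \in \mathcal{A}$ and every $y \in \mathcal{R}(\varphi)$; (2) the set $\mathcal{R}(\varphi)$ is a dense cozero-set in $Y$, and the map $p$ of (1) can be extended to a continuous map from $Y$ into $[0,+\infty]$ taking values in $\{0,+\infty\}$ at every point of $Y \setminus \mathcal{R}(\varphi)$.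
   Context: $I = [0,1]$, and $C(X,I)$ is the semigroup, under pointwise multiplication, of all continuous functions $X \to I$. A semigroup $\mathcal{A} \subset C(X,I)$ is a subset closed under pointwise multiplication. A map $\varphi$ is multiplicative if $\varphi(fg) = \varphi(f)\varphi(g)$ for all $f,g$. For $f \in C(X,I)$, $\mathrm{coz}\, f = \{x \in X : f(x) \neq 0\}$ and $\mathrm{supp}\, f$ is the closure of $\mathrm{coz}\, f$. The properties for a semigroup $\mathcal{A} \subset C(X,I)$ (and likewise for $\mathcal{B} \subset C(Y,I)$ with $Y$ in place of $X$) are: Property 1: given any $x \in X$ and any neighborhood $U$ of $x$, there exists $f \in \mathcal{A}$ such that $f \equiv 1$ on a neighborhood of $x$ and $\mathrm{supp}\, f \subset U$. Property 2: if $f,g \in \mathcal{A}$ satisfy $f(x) \le g(x)$ for every $x \in X$ and $\mathrm{supp}\, f \subset \mathrm{coz}\, g$, then there exists $k \in \mathcal{A}$ such that $f = gk$. Property 3: for each $x \in X$, the set $(0,1) \cap \{f(x) : f \in \mathcal{A}\}$ is nonempty. A point $y \in Y$ is a standard point for $\varphi$ if there exist a number $p \in (0,+\infty)$ and a point $x \in X$ such that $\varphi(f)(y) = f(x)^p$ for every $f \in \mathcal{A}$; $\mathcal{R}(\varphi)$ denotes the set of all standard points for $\varphi$. A subset $Z$ of $Y$ is a cozero-set if there is a continuous function $f: Y \to \mathbb{R}$ with $Z = \{y \in Y : f(y) \neq 0\}$. The interval $[0,+\infty]$ carries its usual (compact, order) topology. *)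

theory Defs
  imports "HOL-Analysis.Analysis"
begin

text \<open>Spaces are values of type \<open>'a topology\<close>, so the empty space is allowed. A function on
  such a space is represented by the function of type \<open>'a \<Rightarrow> real\<close> that is \<open>undefined\<close> outside the
  carrier; HOL equality of such functions is then equality on the carrier, which keeps products,
  injectivity and factorizations faithful.\<close>

definition unit_maps :: "'a topology \<Rightarrow> ('a \<Rightarrow> real) set" where
  "unit_maps X = {f \<in> topspace X \<rightarrow>\<^sub>E {0..1}. continuous_map X euclideanreal f}"

definition pw_mult :: "'a topology \<Rightarrow> ('a \<Rightarrow> real) \<Rightarrow> ('a \<Rightarrow> real) \<Rightarrow> ('a \<Rightarrow> real)" where
  "pw_mult X f g = (\<lambda>x\<in>topspace X. f x * g x)"

definition mult_semigroup :: "'a topology \<Rightarrow> ('a \<Rightarrow> real) set \<Rightarrow> bool" where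
  "mult_semigroup X A \<longleftrightarrow> A \<subseteq> unit_maps X \<and> (\<forall>f\<in>A. \<forall>g\<in>A. pw_mult X f g \<in> A)"

definition multiplicative_on ::
  "'a topology \<Rightarrow> 'b topology \<Rightarrow> ('a \<Rightarrow> real) set \<Rightarrow> (('a \<Rightarrow> real) \<Rightarrow> ('b \<Rightarrow> real)) \<Rightarrow> bool" where
  "multiplicative_on X Y A \<phi> \<longleftrightarrow>
     (\<forall>f\<in>A. \<forall>g\<in>A. \<phi> (pw_mult X f g) = pw_mult Y (\<phi> f) (\<phi> g))"

definition coz :: "'a topology \<Rightarrow> ('a \<Rightarrow> real) \<Rightarrow> 'a set" where
  "coz X f = {x \<in> topspace X. f x \<noteq> 0}"

definition supp :: "'a topology \<Rightarrow> ('a \<Rightarrow> real) \<Rightarrow> 'a set" where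
  "supp X f = X closure_of (coz X f)"

definition cozero_set :: "'a topology \<Rightarrow> 'a set \<Rightarrow> bool" where
  "cozero_set X Z \<longleftrightarrow> (\<exists>f. continuous_map X euclideanreal f \<and> Z = coz X f)"

text \<open>Neighborhoods need not be open.\<close>

definition nbhd_of :: "'a topology \<Rightarrow> 'a \<Rightarrow> 'a set \<Rightarrow> bool" where
  "nbhd_of X x U \<longleftrightarrow> U \<subseteq> topspace X \<and> x \<in> X interior_of U"

definition property1 :: "'a topology \<Rightarrow> ('a \<Rightarrow> real) set \<Rightarrow> bool" where
  "property1 X A \<longleftrightarrow>
     (\<forall>x\<in>topspace X. \<forall>U. nbhd_of X x U \<longrightarrow>
        (\<exists>f\<in>A. (\<exists>V. nbhd_of X x V \<and> (\<forall>v\<in>V. f v = 1)) \<and> supp X f \<subseteq> U))"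

definition property2 :: "'a topology \<Rightarrow> ('a \<Rightarrow> real) set \<Rightarrow> bool" where
  "property2 X A \<longleftrightarrow>
     (\<forall>f\<in>A. \<forall>g\<in>A. (\<forall>x\<in>topspace X. f x \<le> g x) \<and> supp X f \<subseteq> coz X g \<longrightarrow>
        (\<exists>k\<in>A. f = pw_mult X g k))"

definition property3 :: "'a topology \<Rightarrow> ('a \<Rightarrow> real) set \<Rightarrow> bool" where
  "property3 X A \<longleftrightarrow> (\<forall>x\<in>topspace X. {0<..<1} \<inter> {f x | f. f \<in> A} \<noteq> {})"

text \<open>Since \<open>p > 0\<close>, \<open>powr\<close> has the intended value \<open>0\<close> at base \<open>0\<close>.\<close>

definition standard_points ::
  "'a topology \<Rightarrow> 'b topology \<Rightarrow> ('a \<Rightarrow> real) set \<Rightarrow> (('a \<Rightarrow> real) \<Rightarrow> ('b \<Rightarrow> real)) \<Rightarrow> 'b set" where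
  "standard_points X Y A \<phi> =
     {y \<in> topspace Y. \<exists>p>0. \<exists>x\<in>topspace X. \<forall>f\<in>A. \<phi> f y = f x powr p}"

end

theory Submission
  imports Defs
begin

text \<open>The relation \<open>f g = g\<close>, i.e. \<open>f = 1\<close> on the support of \<open>g\<close>, is purely multiplicative, and so is
  disjointness of cozero-sets; chains of these relations determine which \<open>f\<close> are \<open>1\<close> near a given
  point, and hence the homeomorphism \<open>\<mu>\<close>. Property 2 makes \<open>\<phi>\<close> locally monotone where the larger
  function is positive. If \<open>f (\<mu> y)\<close> and \<open>\<phi> f y\<close> both lie in \<open>(0, 1)\<close>, comparing powers of \<open>f\<close> with
  powers of an arbitrary \<open>g\<close> shows that \<open>ln (\<phi> g y)\<close> is a fixed multiple of \<open>ln (g (\<mu> y))\<close>, so \<open>y\<close>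
  is standard; otherwise \<open>\<phi> f y\<close> is \<open>0\<close> or \<open>1\<close>, and the exponent read off from \<open>f\<close> is \<open>\<infinity>\<close> or \<open>0\<close>.\<close>

section \<open>Neighborhood filters and supports\<close>

lemma continuous_map_euclidean_iff_tendsto:
  fixes f :: "'a \<Rightarrow> 'b::topological_space"
  shows "continuous_map X euclidean f \<longleftrightarrow> (\<forall>x\<in>topspace X. (f \<longlongrightarrow> f x) (atin X x))"
  by (simp add: continuous_map_atin)

lemma continuous_map_eventually_nhdsin:
  assumes "continuous_map X Y f" "openin Y U" "x \<in> topspace X" "f x \<in> U"
  shows "eventually (\<lambda>z. f z \<in> U) (nhdsin X x)"
  using assms openin_continuous_map_preimage[OF assms(1,2)]
  by (auto simp: eventually_nhdsin intro!: exI[of _ "{z \<in> topspace X. f z \<in> U}"])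

text \<open>Unlike \<open>atin\<close>, the filter \<open>nhdsin\<close> keeps the point itself;
  outside the carrier it is trivial, hence the second assumption.\<close>

lemma eventually_nhdsin_imp:
  assumes "eventually P (nhdsin X x)" "x \<in> topspace X"
  shows "P x"
  using assms by (auto simp: eventually_nhdsin)

lemma eventually_nhdsin_topspace: "eventually (\<lambda>z. z \<in> topspace X) (nhdsin X x)"
  by (cases "x \<in> topspace X") (auto simp: eventually_nhdsin intro!: exI[of _ "topspace X"])

lemma coz_subset_supp: "coz X f \<subseteq> supp X f"
  unfolding supp_def by (rule closure_of_subset) (auto simp: coz_def)

lemma closedin_supp: "closedin X (supp X f)"
  by (simp add: supp_def)

lemma not_in_supp_iff:
  assumes "x \<in> topspace X"
  shows "x \<notin> supp X f \<longleftrightarrow> eventually (\<lambda>z. f z = 0) (nhdsin X x)"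
proof
  assume "x \<notin> supp X f"
  moreover have "openin X (topspace X - supp X f)"
    by (simp add: closedin_supp openin_diff)
  moreover have "f z = 0" if "z \<in> topspace X - supp X f" for z
    using that coz_subset_supp[of X f] by (auto simp: coz_def)
  ultimately show "eventually (\<lambda>z. f z = 0) (nhdsin X x)"
    using assms unfolding eventually_nhdsin by blast
next
  assume "eventually (\<lambda>z. f z = 0) (nhdsin X x)"
  then obtain V where "openin X V" "x \<in> V" "\<And>z. z \<in> V \<Longrightarrow> f z = 0"
    using assms by (auto simp: eventually_nhdsin)
  then show "x \<notin> supp X f"
    by (auto simp: supp_def in_closure_of coz_def)
qed

section \<open>Powers, logarithms and comparison with rationals\<close>

text \<open>Removes the base \<open>s\<close> from \<open>s powr p\<close>; this is how an exponent
  is read off from a single value.\<close>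

lemma powr_times_minus_inverse_ln:
  fixes s p :: real
  assumes "0 < s" "s < 1"
  shows "(s powr p) powr (- 1 / ln s) = exp (- p)"
  using assms by (simp add: powr_powr powr_def)

text \<open>Numerator and denominator are successors because they will serve as exponents in a
  semigroup that may lack a unit.\<close>

lemma positive_rational_between:
  fixes a b :: real
  assumes "0 \<le> a" "a < b"
  obtains m n where "a < real (Suc m) / real (Suc n)" "real (Suc m) / real (Suc n) < b"
proof -
  obtain r where r: "r \<in> \<rat>" "a < r" "r < b"
    using Rats_dense_in_real[OF assms(2)] by auto
  obtain m n :: nat where mn: "n \<noteq> 0" "\<bar>r\<bar> = real m / real n"
    using Rats_abs_nat_div_natE[OF r(1)] by metis
  have "m \<noteq> 0" using mn r assms by (cases m) auto
  with mn obtain m' n' where "m = Suc m'" "n = Suc n'" by (auto simp: gr0_conv_Suc)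
  with mn r assms have "r = real (Suc m') / real (Suc n')" by simp
  with r that show ?thesis by blast
qed

text \<open>Eudoxus' comparison of ratios: a positive rational strictly between \<open>b / a\<close>
  and \<open>\<beta> / \<alpha>\<close> would contradict one of the two implications, so the ratios
  agree.\<close>

lemma proportional_of_power_comparison:
  fixes a b \<alpha> \<beta> :: real
  assumes pos: "0 < a" "0 < \<alpha>" "0 \<le> b" "0 \<le> \<beta>"
    and less: "\<And>m n. real (Suc n) * b < real (Suc m) * a \<Longrightarrow> real (Suc n) * \<beta> \<le> real (Suc m) * \<alpha>"
    and greater: "\<And>m n. real (Suc m) * a < real (Suc n) * b \<Longrightarrow> real (Suc m) * \<alpha> \<le> real (Suc n) * \<beta>"
  shows "\<beta> = \<alpha> / a * b"
proof -
  have "\<not> b / a < \<beta> / \<alpha>"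
  proof
    assume "b / a < \<beta> / \<alpha>"
    then obtain m n where "b / a < real (Suc m) / real (Suc n)" "real (Suc m) / real (Suc n) < \<beta> / \<alpha>"
      using positive_rational_between[of "b / a" "\<beta> / \<alpha>"] pos by auto
    then show False using less[of n m] pos
      by (simp add: field_simps del: of_nat_Suc)
  qed
  moreover have "\<not> \<beta> / \<alpha> < b / a"
  proof
    assume "\<beta> / \<alpha> < b / a"
    then obtain m n where "\<beta> / \<alpha> < real (Suc m) / real (Suc n)" "real (Suc m) / real (Suc n) < b / a"
      using positive_rational_between[of "\<beta> / \<alpha>" "b / a"] pos by auto
    then show False using greater[of m n] pos
      by (simp add: field_simps del: of_nat_Suc)
  qed
  ultimately have "\<beta> / \<alpha> = b / a" by linarith
  then show ?thesis using pos by (simp add: field_simps)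
qed

lemma power_Suc_below:
  fixes s t :: real
  assumes "0 \<le> s" "s < 1" "0 < t"
  obtains m where "s ^ Suc m < t"
proof -
  obtain m where "s ^ m < t" using real_arch_pow_inv[OF assms(3,2)] by blast
  moreover have "s ^ Suc m \<le> s ^ m" using assms by (intro power_decreasing) auto
  ultimately show ?thesis using that[of m] by linarith
qed

text \<open>On [0, 1] this inverts p \<mapsto> exp (- p), with p in [0, \<infinity>]. For
  \<open>t > 1\<close> the conversion \<open>ennreal\<close> truncates to 0, so continuity holds on
  the whole half-line.\<close>

definition ext_neg_ln :: "real \<Rightarrow> ennreal" where
  "ext_neg_ln t = (if t = 0 then \<infinity> else ennreal (- ln t))"

lemma continuous_on_ext_neg_ln: "continuous_on {0..} ext_neg_ln"
  unfolding continuous_on_def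
proof
  fix x :: real assume "x \<in> {0..}"
  then consider "x = 0" | "0 < x" by force
  then show "(ext_neg_ln \<longlongrightarrow> ext_neg_ln x) (at x within {0..})"
  proof cases
    case 1
    have "{0..} - {0::real} = {0<..} - {0}" by auto
    then have within: "at (0::real) within {0..} = at_right 0" by (simp add: at_within_def)
    have "filterlim (\<lambda>t::real. - ln t) at_top (at_right 0)"
      using ln_at_0 by (simp add: filterlim_uminus_at_top)
    then have "((\<lambda>t::real. ennreal (- ln t)) \<longlongrightarrow> top) (at_right 0)"
      by (simp add: ennreal_tendsto_top_eq_at_top)
    moreover have "eventually (\<lambda>t. ennreal (- ln t) = ext_neg_ln t) (at_right (0::real))"
      using eventually_at_right_less by eventually_elim (simp add: ext_neg_ln_def)
    ultimately show ?thesis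
      unfolding 1 within by (auto simp: ext_neg_ln_def infinity_ennreal_def elim: Lim_transform_eventually)
  next
    case 2
    have "((\<lambda>t. ennreal (- ln t)) \<longlongrightarrow> ennreal (- ln x)) (at x within {0..})"
      using 2 by (intro tendsto_intros) auto
    moreover have "eventually (\<lambda>t. 0 < t) (at x within {0..})"
      using 2 by (intro order_tendstoD(1)[OF tendsto_ident_at])
    then have "eventually (\<lambda>t. ennreal (- ln t) = ext_neg_ln t) (at x within {0..})"
      by eventually_elim (simp add: ext_neg_ln_def)
    ultimately show ?thesis
      using 2 by (auto simp: ext_neg_ln_def elim: Lim_transform_eventually)
  qed
qed

section \<open>Semigroups with the three properties\<close>

locale regular_semigroup =
  fixes X :: "'a topology" and A :: "('a \<Rightarrow> real) set"
  assumes compact: "compact_space X" and hausdorff: "Hausdorff_space X"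
    and semigroup: "mult_semigroup X A" and prop1: "property1 X A"
    and prop2: "property2 X A" and prop3: "property3 X A"
begin

lemma in_unit_maps: "f \<in> A \<Longrightarrow> f \<in> unit_maps X"
  using semigroup by (auto simp: mult_semigroup_def)

lemma nonneg: "f \<in> A \<Longrightarrow> x \<in> topspace X \<Longrightarrow> 0 \<le> f x"
  using in_unit_maps[of f] by (auto simp: unit_maps_def PiE_iff)

lemma le_one: "f \<in> A \<Longrightarrow> x \<in> topspace X \<Longrightarrow> f x \<le> 1"
  using in_unit_maps[of f] by (auto simp: unit_maps_def PiE_iff)

lemma continuous: "f \<in> A \<Longrightarrow> continuous_map X euclideanreal f"
  using in_unit_maps by (auto simp: unit_maps_def)

lemma eqI: "f \<in> A \<Longrightarrow> g \<in> A \<Longrightarrow> (\<And>x. x \<in> topspace X \<Longrightarrow> f x = g x) \<Longrightarrow> f = g"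
  using in_unit_maps[of f] in_unit_maps[of g]
  by (auto simp: unit_maps_def PiE_iff intro: extensionalityI)

lemma mult_closed: "f \<in> A \<Longrightarrow> g \<in> A \<Longrightarrow> pw_mult X f g \<in> A"
  using semigroup by (auto simp: mult_semigroup_def)

lemma openin_coz: "f \<in> A \<Longrightarrow> openin X (coz X f)"
  using openin_continuous_map_preimage[OF continuous, of f "- {0}"]
  by (auto simp: coz_def)

lemma bump:
  assumes "openin X U" "x \<in> U"
  obtains f where "f \<in> A" "eventually (\<lambda>z. f z = 1) (nhdsin X x)" "supp X f \<subseteq> U"
proof -
  have x: "x \<in> topspace X" using assms openin_subset by blast
  have "nbhd_of X x U"
    using assms openin_subset by (auto simp: nbhd_of_def interior_of_openin)
  then obtain f V where f: "f \<in> A" "nbhd_of X x V" "\<forall>v\<in>V. f v = 1" "supp X f \<subseteq> U"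
    using prop1 x by (meson property1_def)
  have "eventually (\<lambda>z. f z = 1) (nhdsin X x)"
    unfolding eventually_nhdsin
    using f(2,3) interior_of_subset[of X V]
    by (intro disjI2 exI[of _ "X interior_of V"]) (auto simp: nbhd_of_def)
  then show ?thesis using that[OF f(1)] f(4) by blast
qed

lemma separating_bump:
  assumes "x \<in> topspace X" "x' \<in> topspace X" "x \<noteq> x'"
  obtains f where "f \<in> A" "eventually (\<lambda>z. f z = 1) (nhdsin X x)" "x' \<notin> supp X f"
proof -
  have "openin X (topspace X - {x'})"
    using hausdorff assms by (simp add: closedin_Hausdorff_singleton openin_diff)
  moreover have "x \<in> topspace X - {x'}" using assms by simp
  ultimately obtain f where "f \<in> A" "eventually (\<lambda>z. f z = 1) (nhdsin X x)"
    "supp X f \<subseteq> topspace X - {x'}"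
    by (rule bump)
  then show ?thesis by (intro that[of f]) auto
qed

lemma value_between:
  assumes "x \<in> topspace X"
  obtains f where "f \<in> A" "0 < f x" "f x < 1"
  using prop3 assms by (fastforce simp: property3_def)

lemma factor:
  assumes "f \<in> A" "g \<in> A" "\<And>x. x \<in> topspace X \<Longrightarrow> f x \<le> g x" "supp X f \<subseteq> coz X g"
  obtains k where "k \<in> A" "f = pw_mult X g k"
  using prop2 assms unfolding property2_def by metis

end

section \<open>Relations preserved by a multiplicative bijection\<close>

locale semigroup_iso =
  X: regular_semigroup X A + Y: regular_semigroup Y B
  for X :: "'a topology" and A and Y :: "'b topology" and B +
  fixes \<phi> :: "('a \<Rightarrow> real) \<Rightarrow> ('b \<Rightarrow> real)"
  assumes multiplicative: "multiplicative_on X Y A \<phi>" and bij: "bij_betw \<phi> A B"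
begin

lemma maps: "f \<in> A \<Longrightarrow> \<phi> f \<in> B"
  using bij by (auto simp: bij_betw_def)

lemma preimage:
  assumes "b \<in> B"
  obtains f where "f \<in> A" "\<phi> f = b"
  using bij assms by (auto simp: bij_betw_def)

lemma mult_apply:
  "f \<in> A \<Longrightarrow> g \<in> A \<Longrightarrow> y \<in> topspace Y \<Longrightarrow> \<phi> (pw_mult X f g) y = \<phi> f y * \<phi> g y"
  using multiplicative by (auto simp: multiplicative_on_def pw_mult_def)

text \<open>The hypotheses are symmetric in the two sides, so every fact about \<phi> can be reused
  for its inverse; this supplies the converse directions below.\<close>

lemma inverse_iso: "semigroup_iso Y B X A (inv_into A \<phi>)"
proof (unfold_locales)
  show "bij_betw (inv_into A \<phi>) B A" by (rule bij_betw_inv_into[OF bij])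
  show "multiplicative_on Y X B (inv_into A \<phi>)"
    unfolding multiplicative_on_def
  proof (intro ballI)
    fix b c assume "b \<in> B" "c \<in> B"
    then obtain f g where "f \<in> A" "\<phi> f = b" "g \<in> A" "\<phi> g = c" by (metis preimage)
    moreover from this have "\<phi> (pw_mult X f g) = pw_mult Y b c"
      using multiplicative by (auto simp: multiplicative_on_def)
    ultimately show "inv_into A \<phi> (pw_mult Y b c) = pw_mult X (inv_into A \<phi> b) (inv_into A \<phi> c)"
      by (metis X.mult_closed bij bij_betw_inv_into_left)
  qed
qed

lemma inverse_apply: "f \<in> A \<Longrightarrow> inv_into A \<phi> (\<phi> f) = f"
  by (rule bij_betw_inv_into_left[OF bij])

text \<open>The third assumption amounts to the equation f g = f, which \<phi> carries over to
  \<open>Y\<close>.\<close>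

lemma one_on_coz:
  assumes "f \<in> A" "g \<in> A" "\<And>x. x \<in> topspace X \<Longrightarrow> g x = 1 \<or> f x = 0" "y \<in> topspace Y"
  shows "\<phi> g y = 1 \<or> \<phi> f y = 0"
proof -
  have "pw_mult X f g = f"
    using assms by (intro X.eqI X.mult_closed) (auto simp: pw_mult_def)
  then show ?thesis using mult_apply[OF assms(1,2,4)] by auto
qed

text \<open>The zero map is absorbing, so its image is absorbing in \<open>B\<close>; by property 3 such an
  element vanishes everywhere.\<close>

lemma map_zero:
  assumes "f \<in> A" "\<And>x. x \<in> topspace X \<Longrightarrow> f x = 0" "y \<in> topspace Y"
  shows "\<phi> f y = 0"
proof -
  obtain b where "b \<in> B" and b: "0 < b y" "b y < 1" using Y.value_between[OF assms(3)] .
  then obtain g where g: "g \<in> A" "\<phi> g = b" using preimage by metis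
  have "pw_mult X f g = f"
    using assms g by (intro X.eqI X.mult_closed) (auto simp: pw_mult_def)
  then have "\<phi> f y = \<phi> f y * b y" using mult_apply[OF assms(1) g(1) assms(3)] g by auto
  then show ?thesis using b by auto
qed

text \<open>Disjoint cozero-sets mean that the product is the zero map, whose image vanishes by
  \<open>map_zero\<close>.\<close>

lemma disjoint:
  assumes "f \<in> A" "g \<in> A" "\<And>x. x \<in> topspace X \<Longrightarrow> f x = 0 \<or> g x = 0" "y \<in> topspace Y"
  shows "\<phi> f y = 0 \<or> \<phi> g y = 0"
proof -
  have "\<phi> (pw_mult X f g) y = 0"
    using assms by (intro map_zero X.mult_closed) (auto simp: pw_mult_def)
  then show ?thesis using mult_apply[OF assms(1,2,4)] by auto
qed

lemma disjoint_converse: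
  assumes "f \<in> A" "g \<in> A" "\<And>y. y \<in> topspace Y \<Longrightarrow> \<phi> f y = 0 \<or> \<phi> g y = 0" "x \<in> topspace X"
  shows "f x = 0 \<or> g x = 0"
proof -
  interpret inv: semigroup_iso Y B X A "inv_into A \<phi>" by (rule inverse_iso)
  show ?thesis using inv.disjoint[of "\<phi> f" "\<phi> g" x] assms by (simp add: maps inverse_apply)
qed

lemma power_closed:
  assumes "f \<in> A"
  obtains h where "h \<in> A" "\<And>x. x \<in> topspace X \<Longrightarrow> h x = f x ^ Suc n"
    "\<And>y. y \<in> topspace Y \<Longrightarrow> \<phi> h y = \<phi> f y ^ Suc n"
proof -
  have "\<exists>h\<in>A. (\<forall>x\<in>topspace X. h x = f x ^ Suc n) \<and> (\<forall>y\<in>topspace Y. \<phi> h y = \<phi> f y ^ Suc n)"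
  proof (induction n)
    case 0
    show ?case using assms by auto
  next
    case (Suc n)
    then obtain h where "h \<in> A" "\<forall>x\<in>topspace X. h x = f x ^ Suc n"
      "\<forall>y\<in>topspace Y. \<phi> h y = \<phi> f y ^ Suc n" by blast
    then show ?case using assms
      by (intro bexI[of _ "pw_mult X f h"] conjI)
        (auto simp: mult_apply X.mult_closed, simp add: pw_mult_def)
  qed
  with that show ?thesis by blast
qed

subsection \<open>The underlying homeomorphism\<close>

text \<open>A relation at first, later seen to be the graph of the homeomorphism: compactness gives
  existence of \<open>x\<close>, separation of points gives uniqueness.\<close>

definition corr :: "'b \<Rightarrow> 'a \<Rightarrow> bool" where
  "corr y x \<longleftrightarrow> y \<in> topspace Y \<and> x \<in> topspace X \<and>
     (\<forall>f\<in>A. eventually (\<lambda>z. \<phi> f z = 1) (nhdsin Y y) \<longrightarrow> x \<in> supp X f)"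

text \<open>Finite intersection property: the functions whose image is 1 near \<open>y\<close> are
  closed under products, the support of a product lies in those of its factors, and none of these
  supports is empty, since the zero map has image 0 at \<open>y\<close>.\<close>

lemma corr_ex:
  assumes y: "y \<in> topspace Y"
  shows "\<exists>x. corr y x"
proof -
  define S where "S = {f \<in> A. eventually (\<lambda>z. \<phi> f z = 1) (nhdsin Y y)}"
  \<comment> \<open>The element \<open>e\<close> makes \<open>S\<close> nonempty: it settles the
    empty subfamily and later places the common point in the carrier.\<close>
  obtain b where "b \<in> B" "eventually (\<lambda>z. b z = 1) (nhdsin Y y)"
    using Y.bump[OF openin_topspace y] .
  moreover from this(1) obtain e where "e \<in> A" "\<phi> e = b" by (rule preimage)
  ultimately have e: "e \<in> S" by (simp add: S_def)
  have prod: "\<exists>g\<in>S. \<forall>f\<in>F. supp X g \<subseteq> supp X f" if "finite F" "F \<subseteq> S" for F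
    using that
  proof (induction F)
    case empty
    show ?case using e by blast
  next
    case (insert f F)
    then obtain g where g: "g \<in> S" "\<forall>h\<in>F. supp X g \<subseteq> supp X h" by auto
    have fg: "f \<in> A" "g \<in> A" using insert.prems g by (auto simp: S_def)
    have "eventually (\<lambda>z. z \<in> topspace Y) (nhdsin Y y)"
      by (rule eventually_nhdsin_topspace)
    moreover have "eventually (\<lambda>z. \<phi> f z = 1) (nhdsin Y y)" "eventually (\<lambda>z. \<phi> g z = 1) (nhdsin Y y)"
      using insert.prems g by (auto simp: S_def)
    ultimately have "eventually (\<lambda>z. \<phi> (pw_mult X f g) z = 1) (nhdsin Y y)"
      by eventually_elim (simp add: mult_apply fg)
    then have "pw_mult X f g \<in> S" using fg by (simp add: S_def X.mult_closed)
    moreover have "supp X (pw_mult X f g) \<subseteq> supp X f" "supp X (pw_mult X f g) \<subseteq> supp X g"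
      unfolding supp_def by (rule closure_of_mono; auto simp: coz_def pw_mult_def)+
    ultimately show ?case using g(2) by (intro bexI[of _ "pw_mult X f g"]) auto
  qed
  have nonempty: "supp X g \<noteq> {}" if "g \<in> S" for g
  proof
    assume "supp X g = {}"
    then have "\<phi> g y = 0" using that y coz_subset_supp[of X g]
      by (intro map_zero) (auto simp: S_def coz_def)
    moreover have "\<phi> g y = 1" using that y by (auto simp: S_def dest: eventually_nhdsin_imp)
    ultimately show False by simp
  qed
  have "\<Inter> (supp X ` S) \<noteq> {}"
  proof (rule X.compact[unfolded compact_space_fip, rule_format], intro conjI ballI allI impI)
    fix C assume "C \<in> supp X ` S"
    then show "closedin X C" by (auto simp: closedin_supp)
  next
    fix \<F> assume "finite \<F> \<and> \<F> \<subseteq> supp X ` S"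
    then obtain F where F: "F \<subseteq> S" "finite F" "\<F> = supp X ` F"
      using finite_subset_image[of \<F> "supp X" S] by auto
    obtain g where g: "g \<in> S" "\<forall>f\<in>F. supp X g \<subseteq> supp X f"
      using prod[OF F(2,1)] by auto
    then have "supp X g \<subseteq> \<Inter>\<F>" using F by auto
    then show "\<Inter>\<F> \<noteq> {}" using nonempty[OF g(1)] by auto
  qed
  then obtain x where "\<And>f. f \<in> S \<Longrightarrow> x \<in> supp X f" by auto
  moreover from this[OF e] have "x \<in> topspace X"
    using closedin_subset[OF closedin_supp[of X e]] by blast
  ultimately show ?thesis using y by (auto simp: corr_def S_def)
qed

text \<open>Otherwise a bump at \<open>y\<close> misses \<open>\<phi> f\<close>. Its preimage
  \<open>g\<close> is then disjoint from \<open>f\<close>, so it vanishes near \<open>x\<close>,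
  although \<open>corr\<close> puts \<open>x\<close> in its support.\<close>

lemma corr_supp:
  assumes "corr y x" "f \<in> A" "eventually (\<lambda>z. f z = 1) (nhdsin X x)"
  shows "y \<in> supp Y (\<phi> f)"
proof (rule ccontr)
  have xy: "x \<in> topspace X" "y \<in> topspace Y" using assms by (auto simp: corr_def)
  assume "y \<notin> supp Y (\<phi> f)"
  then have "y \<in> topspace Y - supp Y (\<phi> f)" "openin Y (topspace Y - supp Y (\<phi> f))"
    using xy by (auto simp: closedin_supp openin_diff)
  then obtain b where b: "b \<in> B" "eventually (\<lambda>z. b z = 1) (nhdsin Y y)"
    "supp Y b \<subseteq> topspace Y - supp Y (\<phi> f)" using Y.bump by metis
  then obtain g where g: "g \<in> A" "\<phi> g = b" using preimage by metis
  have "\<phi> g z = 0 \<or> \<phi> f z = 0" if "z \<in> topspace Y" for z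
    using b g that coz_subset_supp[of Y b] coz_subset_supp[of Y "\<phi> f"] by (auto simp: coz_def)
  then have gf: "g z = 0 \<or> f z = 0" if "z \<in> topspace X" for z
    using disjoint_converse g(1) assms(2) that by metis
  have "eventually (\<lambda>z. z \<in> topspace X) (nhdsin X x)"
      by (rule eventually_nhdsin_topspace)
  with assms(3) have "eventually (\<lambda>z. g z = 0) (nhdsin X x)"
    by eventually_elim (use gf in force)
  then have "x \<notin> supp X g" by (simp add: not_in_supp_iff xy)
  moreover have "x \<in> supp X g" using assms(1) g b by (auto simp: corr_def)
  ultimately show False by simp
qed

text \<open>A chain \<open>f\<close>, \<open>g\<close>, \<open>h\<close>, each equal to 1 on the
  cozero-set of the next, upgrades membership of \<open>y\<close> in the support of
  \<open>\<phi> h\<close> to \<open>\<phi> f\<close> being 1 on the open set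
  \<open>coz Y (\<phi> g)\<close> around \<open>y\<close>.\<close>

lemma corr_one:
  assumes c: "corr y x" and f: "f \<in> A" "eventually (\<lambda>z. f z = 1) (nhdsin X x)"
  shows "eventually (\<lambda>z. \<phi> f z = 1) (nhdsin Y y)"
proof -
  have xy: "x \<in> topspace X" "y \<in> topspace Y" using c by (auto simp: corr_def)
  obtain V where V: "openin X V" "x \<in> V" "\<And>z. z \<in> V \<Longrightarrow> f z = 1"
    using f(2) xy by (auto simp: eventually_nhdsin)
  obtain g where g: "g \<in> A" "eventually (\<lambda>z. g z = 1) (nhdsin X x)" "supp X g \<subseteq> V"
    using X.bump[OF V(1,2)] .
  obtain W where W: "openin X W" "x \<in> W" "\<And>z. z \<in> W \<Longrightarrow> g z = 1"
    using g(2) xy by (auto simp: eventually_nhdsin)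
  obtain h where h: "h \<in> A" "eventually (\<lambda>z. h z = 1) (nhdsin X x)" "supp X h \<subseteq> W"
    using X.bump[OF W(1,2)] .
  have "f z = 1 \<or> g z = 0" if "z \<in> topspace X" for z
    using V(3) g(3) coz_subset_supp[of X g] that by (auto simp: coz_def)
  then have fg: "\<phi> f z = 1 \<or> \<phi> g z = 0" if "z \<in> topspace Y" for z
    using one_on_coz[of g f] f(1) g(1) that by blast
  have "g z = 1 \<or> h z = 0" if "z \<in> topspace X" for z
    using W(3) h(3) coz_subset_supp[of X h] that by (auto simp: coz_def)
  then have gh: "\<phi> g z = 1 \<or> \<phi> h z = 0" if "z \<in> topspace Y" for z
    using one_on_coz[of h g] h(1) g(1) that by blast
  have "y \<in> supp Y (\<phi> h)" using corr_supp[OF c h(1,2)] .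
  \<comment> \<open>\<open>\<phi> g\<close> is 1 on \<open>coz Y (\<phi> h)\<close>, hence on its
    closure, because the set where it is 1 is closed.\<close>
  also have "supp Y (\<phi> h) \<subseteq> {z \<in> topspace Y. \<phi> g z \<in> {1}}"
    unfolding supp_def
    using gh closedin_continuous_map_preimage[OF Y.continuous[OF maps[OF g(1)]], of "{1}"]
    by (intro closure_of_minimal) (auto simp: coz_def)
  finally have "y \<in> coz Y (\<phi> g)" using xy by (simp add: coz_def)
  moreover have "openin Y (coz Y (\<phi> g))" by (simp add: Y.openin_coz maps g)
  ultimately show ?thesis
    unfolding eventually_nhdsin using fg
    by (intro disjI2 exI[of _ "coz Y (\<phi> g)"]) (auto simp: coz_def)
qed

text \<open>\<open>corr_supp\<close> is exactly the defining condition for the inverse map. Through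
  this symmetry, uniqueness for the inverse yields injectivity of \<mu>.\<close>

lemma corr_inverse:
  assumes "corr y x"
  shows "semigroup_iso.corr Y B X (inv_into A \<phi>) x y"
proof -
  interpret inv: semigroup_iso Y B X A "inv_into A \<phi>" by (rule inverse_iso)
  show ?thesis
    unfolding inv.corr_def
  proof (intro conjI ballI impI)
    fix b assume b: "b \<in> B" "eventually (\<lambda>z. inv_into A \<phi> b z = 1) (nhdsin X x)"
    then obtain f where "f \<in> A" "\<phi> f = b" by (metis preimage)
    then show "y \<in> supp Y b" using b corr_supp[OF assms] inverse_apply by metis
  qed (use assms in \<open>auto simp: corr_def\<close>)
qed

text \<open>A bump at \<open>x\<close> whose support misses \<open>x'\<close> has image 1 near
  \<open>y\<close>, which forces \<open>x'\<close> into that support.\<close>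

lemma corr_unique:
  assumes "corr y x" "corr y x'"
  shows "x = x'"
proof (rule ccontr)
  assume "x \<noteq> x'"
  then obtain f where f: "f \<in> A" "eventually (\<lambda>z. f z = 1) (nhdsin X x)" "x' \<notin> supp X f"
    using X.separating_bump assms by (metis corr_def)
  show False using corr_one[OF assms(1) f(1,2)] assms(2) f by (auto simp: corr_def)
qed

definition \<mu> :: "'b \<Rightarrow> 'a" where "\<mu> y = (SOME x. corr y x)"

lemma corr_mu: "y \<in> topspace Y \<Longrightarrow> corr y (\<mu> y)"
  unfolding \<mu>_def using corr_ex by (metis someI_ex)

lemma mu_in: "y \<in> topspace Y \<Longrightarrow> \<mu> y \<in> topspace X"
  using corr_mu by (auto simp: corr_def)

text \<open>A continuous bijection from a compact space to a Hausdorff space suffices. For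
  continuity, a bump supported in \<open>U\<close> has image 1 on some open \<open>V\<close> around
  \<open>y\<close>, and \<open>corr\<close> then puts \<mu> of every point of \<open>V\<close> in
  its support.\<close>

lemma homeomorphic_map_mu: "homeomorphic_map Y X \<mu>"
proof (rule continuous_imp_homeomorphic_map)
  interpret inv: semigroup_iso Y B X A "inv_into A \<phi>" by (rule inverse_iso)
  show "inj_on \<mu> (topspace Y)"
    by (rule inj_onI) (metis corr_mu corr_inverse inv.corr_unique)
  have "x \<in> \<mu> ` topspace Y" if x: "x \<in> topspace X" for x
  proof -
    obtain y where "inv.corr x y" using inv.corr_ex[OF x] by blast
    then have y: "y \<in> topspace Y" by (simp add: inv.corr_def)
    \<comment> \<open>Checked from the definition, since \<open>inv.corr_inverse\<close> would speak
      of the inverse of \<open>inv_into A \<phi>\<close>, which need not equal \<phi> outside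
      \<open>A\<close>.\<close>
    have "corr y x"
      unfolding corr_def
    proof (intro conjI ballI impI x y)
      fix f assume "f \<in> A" "eventually (\<lambda>z. \<phi> f z = 1) (nhdsin Y y)"
      then show "x \<in> supp X f"
        using inv.corr_supp[OF \<open>inv.corr x y\<close>, of "\<phi> f"] by (simp add: maps inverse_apply)
    qed
    then show ?thesis using corr_unique corr_mu y by blast
  qed
  then show "\<mu> ` topspace Y = topspace X" using mu_in by auto
  show "continuous_map Y X \<mu>"
    unfolding continuous_map_atin limitin_def
  proof (intro ballI conjI allI impI mu_in)
    fix y U assume y: "y \<in> topspace Y" and U: "openin X U \<and> \<mu> y \<in> U"
    then obtain f where f: "f \<in> A" "eventually (\<lambda>z. f z = 1) (nhdsin X (\<mu> y))" "supp X f \<subseteq> U"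
      using X.bump by metis
    obtain V where V: "openin Y V" "y \<in> V" "\<And>z. z \<in> V \<Longrightarrow> \<phi> f z = 1"
      using corr_one[OF corr_mu[OF y] f(1,2)] y by (auto simp: eventually_nhdsin)
    have "\<mu> z \<in> U" if "z \<in> V" for z
    proof -
      have "z \<in> topspace Y" using V(1) that openin_subset by blast
      moreover have "eventually (\<lambda>z. \<phi> f z = 1) (nhdsin Y z)"
        unfolding eventually_nhdsin using V that by blast
      ultimately show ?thesis using corr_mu[of z] f by (auto simp: corr_def)
    qed
    with V show "eventually (\<lambda>z. \<mu> z \<in> U) (atin Y y)"
      unfolding eventually_atin by auto
  qed
qed (use Y.compact X.hausdorff in auto)

lemma continuous_map_mu: "continuous_map Y X \<mu>"
  using homeomorphic_map_mu homeomorphic_imp_continuous_map by blast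

lemma near_one_iff:
  assumes "y \<in> topspace Y" "f \<in> A"
  shows "eventually (\<lambda>z. \<phi> f z = 1) (nhdsin Y y) \<longleftrightarrow> eventually (\<lambda>z. f z = 1) (nhdsin X (\<mu> y))"
proof -
  interpret inv: semigroup_iso Y B X A "inv_into A \<phi>" by (rule inverse_iso)
  show ?thesis
    using corr_one[OF corr_mu] inv.corr_one[OF corr_inverse[OF corr_mu], of y "\<phi> f"] assms
    by (auto simp: maps inverse_apply)
qed

text \<open>A bump at \<open>x\<close> supported where \<open>f\<close> vanishes is disjoint from
  \<open>f\<close>; its image is 1 near \<open>y\<close>, so \<open>\<phi> f\<close> must vanish
  there.\<close>

lemma corr_zero:
  assumes c: "corr y x" and f: "f \<in> A" "eventually (\<lambda>z. f z = 0) (nhdsin X x)"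
  shows "eventually (\<lambda>z. \<phi> f z = 0) (nhdsin Y y)"
proof -
  have xy: "x \<in> topspace X" "y \<in> topspace Y" using c by (auto simp: corr_def)
  obtain V where V: "openin X V" "x \<in> V" "\<And>z. z \<in> V \<Longrightarrow> f z = 0"
    using f(2) xy by (auto simp: eventually_nhdsin)
  obtain g where g: "g \<in> A" "eventually (\<lambda>z. g z = 1) (nhdsin X x)" "supp X g \<subseteq> V"
    using X.bump[OF V(1,2)] .
  have "f z = 0 \<or> g z = 0" if "z \<in> topspace X" for z
    using V(3) g(3) coz_subset_supp[of X g] that by (auto simp: coz_def)
  then have fg: "\<phi> f z = 0 \<or> \<phi> g z = 0" if "z \<in> topspace Y" for z
    using disjoint[of f g] f(1) g(1) that by blast
  have "eventually (\<lambda>z. z \<in> topspace Y) (nhdsin Y y)"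
      by (rule eventually_nhdsin_topspace)
  with corr_one[OF c g(1,2)] show ?thesis
    by eventually_elim (use fg in force)
qed

lemma near_zero_iff:
  assumes "y \<in> topspace Y" "f \<in> A"
  shows "eventually (\<lambda>z. \<phi> f z = 0) (nhdsin Y y) \<longleftrightarrow> eventually (\<lambda>z. f z = 0) (nhdsin X (\<mu> y))"
proof -
  interpret inv: semigroup_iso Y B X A "inv_into A \<phi>" by (rule inverse_iso)
  show ?thesis
    using corr_zero[OF corr_mu] inv.corr_zero[OF corr_inverse[OF corr_mu], of y "\<phi> f"] assms
    by (auto simp: maps inverse_apply)
qed

subsection \<open>Local order and standard points\<close>

text \<open>Cut-offs \<open>l\<close> and \<open>h\<close>, with \<open>h\<close> equal to 1 on the
  support of \<open>l\<close>, turn the local inequality into a global one between f l and g h.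
  Property 2 then gives f l = g h k, and \<open>\<phi> k\<close> is at most 1.\<close>

lemma local_mono:
  assumes y: "y \<in> topspace Y" and fg: "f \<in> A" "g \<in> A"
    and le: "eventually (\<lambda>z. f z \<le> g z \<and> 0 < g z) (nhdsin X (\<mu> y))"
  shows "\<phi> f y \<le> \<phi> g y"
proof -
  have x: "\<mu> y \<in> topspace X" using y by (rule mu_in)
  obtain V where V: "openin X V" "\<mu> y \<in> V" "\<And>z. z \<in> V \<Longrightarrow> f z \<le> g z \<and> 0 < g z"
    using le x by (auto simp: eventually_nhdsin)
  obtain h where h: "h \<in> A" "eventually (\<lambda>z. h z = 1) (nhdsin X (\<mu> y))" "supp X h \<subseteq> V"
    using X.bump[OF V(1,2)] .
  obtain W where W: "openin X W" "\<mu> y \<in> W" "\<And>z. z \<in> W \<Longrightarrow> h z = 1"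
    using h(2) x by (auto simp: eventually_nhdsin)
  \<comment> \<open>\<open>h\<close> is nonzero on \<open>W\<close>, so \<open>W\<close> lies in its
    support.\<close>
  have WV: "W \<subseteq> V" using W openin_subset[OF W(1)] h(3) coz_subset_supp[of X h]
    by (force simp: coz_def)
  obtain l where l: "l \<in> A" "eventually (\<lambda>z. l z = 1) (nhdsin X (\<mu> y))" "supp X l \<subseteq> W"
    using X.bump[OF W(1,2)] .
  let ?F = "pw_mult X f l" and ?G = "pw_mult X g h"
  have F: "?F \<in> A" "?G \<in> A" using fg h l by (auto intro: X.mult_closed)
  have le: "?F z \<le> ?G z" if z: "z \<in> topspace X" for z
  proof (cases "z \<in> W")
    case True
    have "f z * l z \<le> f z * 1"
      using z fg l X.nonneg X.le_one by (intro mult_left_mono) auto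
    also have "\<dots> \<le> g z * h z" using True W V WV by auto
    finally show ?thesis using z by (simp add: pw_mult_def)
  next
    case False
    then have "l z = 0" using l(3) coz_subset_supp[of X l] z by (auto simp: coz_def)
    then show ?thesis using z F X.nonneg[of ?G z] by (simp add: pw_mult_def)
  qed
  have "supp X ?F \<subseteq> supp X l"
    unfolding supp_def by (rule closure_of_mono) (auto simp: coz_def pw_mult_def)
  also have "\<dots> \<subseteq> coz X ?G"
  proof
    fix z assume "z \<in> supp X l"
    with l have "z \<in> W" by blast
    then show "z \<in> coz X ?G" using W V WV openin_subset[OF W(1)]
      by (force simp: coz_def pw_mult_def)
  qed
  finally obtain k where k: "k \<in> A" "?F = pw_mult X ?G k"
    using X.factor[OF F le] by blast
  \<comment> \<open>The cut-offs are 1 near \<open>\<mu> y\<close>, so multiplying by their images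
    changes nothing at \<open>y\<close>.\<close>
  have "\<phi> l y = 1" "\<phi> h y = 1"
    using near_one_iff[OF y] l h y eventually_nhdsin_imp by metis+
  then have "\<phi> f y = \<phi> ?F y" "\<phi> g y = \<phi> ?G y" using fg h l y by (simp_all add: mult_apply)
  moreover have "\<phi> ?F y = \<phi> ?G y * \<phi> k y" using k F y by (simp add: mult_apply)
  moreover have "\<phi> ?G y * \<phi> k y \<le> \<phi> ?G y"
    using Y.le_one[OF maps[OF k(1)] y] Y.nonneg[OF maps[OF F(2)] y] by (simp add: mult_left_le)
  ultimately show ?thesis by simp
qed

text \<open>By continuity the strict inequality persists near \<open>\<mu> y\<close> and makes the
  larger power positive there, as \<open>local_mono\<close> demands; only a weak inequality
  survives.\<close>

lemma power_mono_at:
  assumes y: "y \<in> topspace Y" and fg: "f \<in> A" "g \<in> A" and less: "f (\<mu> y) ^ Suc m < g (\<mu> y) ^ Suc n"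
  shows "\<phi> f y ^ Suc m \<le> \<phi> g y ^ Suc n"
proof -
  have x: "\<mu> y \<in> topspace X" using y by (rule mu_in)
  obtain F where F: "F \<in> A" "\<And>x. x \<in> topspace X \<Longrightarrow> F x = f x ^ Suc m"
    "\<And>y. y \<in> topspace Y \<Longrightarrow> \<phi> F y = \<phi> f y ^ Suc m" using power_closed[OF fg(1)] by metis
  obtain G where G: "G \<in> A" "\<And>x. x \<in> topspace X \<Longrightarrow> G x = g x ^ Suc n"
    "\<And>y. y \<in> topspace Y \<Longrightarrow> \<phi> G y = \<phi> g y ^ Suc n" using power_closed[OF fg(2)] by metis
  have "continuous_map X euclideanreal (\<lambda>z. G z - F z)"
    by (intro continuous_map_diff X.continuous F G)
  then have "eventually (\<lambda>z. G z - F z \<in> {0<..}) (nhdsin X (\<mu> y))"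
    using x less by (intro continuous_map_eventually_nhdsin) (auto simp: F G)
  moreover have "eventually (\<lambda>z. z \<in> topspace X) (nhdsin X (\<mu> y))"
      by (rule eventually_nhdsin_topspace)
  ultimately have "eventually (\<lambda>z. F z \<le> G z \<and> 0 < G z) (nhdsin X (\<mu> y))"
    by eventually_elim (use X.nonneg[OF F(1)] in force)
  then show ?thesis using local_mono[OF y F(1) G(1)] F G y by simp
qed

lemma power_formula:
  assumes y: "y \<in> topspace Y" and f: "f \<in> A" "0 < f (\<mu> y)" "f (\<mu> y) < 1" "0 < \<phi> f y" "\<phi> f y < 1"
    and g: "g \<in> A"
  shows "\<phi> g y = g (\<mu> y) powr (ln (\<phi> f y) / ln (f (\<mu> y)))"
proof (cases "g (\<mu> y) = 0")
  case True
  \<comment> \<open>\<open>g (\<mu> y) = 0\<close> lies below every power of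
    \<open>f (\<mu> y)\<close>; the corresponding powers of \<open>\<phi> f y\<close> tend to
    0.\<close>
  have bound: "\<phi> g y \<le> \<phi> f y ^ Suc m" for m
    using power_mono_at[OF y g f(1), of 0 m] True f by simp
  have "(\<lambda>m. \<phi> f y ^ Suc m) \<longlonglongrightarrow> 0"
    using f by (intro LIMSEQ_Suc LIMSEQ_power_zero) auto
  then have "\<phi> g y \<le> 0" using bound by (intro LIMSEQ_le_const) auto
  then show ?thesis using Y.nonneg[OF maps[OF g] y] True by simp
next
  case False
  have x: "\<mu> y \<in> topspace X" using y by (rule mu_in)
  have gpos: "0 < g (\<mu> y)" using False X.nonneg[OF g x] by simp
  \<comment> \<open>Before logarithms are taken, \<open>\<phi> g y\<close> must be positive: it
    dominates a power of the positive number \<open>\<phi> f y\<close>.\<close>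
  obtain m where "f (\<mu> y) ^ Suc m < g (\<mu> y)"
    using power_Suc_below[of "f (\<mu> y)" "g (\<mu> y)"] f gpos by auto
  then have "f (\<mu> y) ^ Suc m < g (\<mu> y) ^ Suc 0" by simp
  then have "\<phi> f y ^ Suc m \<le> \<phi> g y ^ Suc 0" using power_mono_at[OF y f(1) g] by blast
  then have pgpos: "0 < \<phi> g y" using f by (smt (verit) power_one_right zero_less_power One_nat_def)
  have ln_less: "real (Suc m) * ln s < real (Suc n) * ln t \<longleftrightarrow> s ^ Suc m < t ^ Suc n"
    and ln_le: "real (Suc m) * ln s \<le> real (Suc n) * ln t \<longleftrightarrow> s ^ Suc m \<le> t ^ Suc n"
    if "0 < s" "0 < t" for s t :: real and m n
    using that by (simp_all only: ln_realpow[symmetric] ln_less_cancel_iff ln_le_cancel_iff zero_less_power)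
  \<comment> \<open>Negating the logarithms meets the sign assumptions of the comparison lemma and
    reverses the order of the powers.\<close>
  have "- ln (\<phi> g y) = - ln (\<phi> f y) / - ln (f (\<mu> y)) * - ln (g (\<mu> y))"
  proof (rule proportional_of_power_comparison)
    show "0 \<le> - ln (g (\<mu> y))" "0 \<le> - ln (\<phi> g y)"
      using gpos pgpos X.le_one[OF g x] Y.le_one[OF maps[OF g] y] by simp_all
    show "0 < - ln (f (\<mu> y))" "0 < - ln (\<phi> f y)" using f by simp_all
    fix m n
    show "real (Suc n) * - ln (\<phi> g y) \<le> real (Suc m) * - ln (\<phi> f y)"
      if "real (Suc n) * - ln (g (\<mu> y)) < real (Suc m) * - ln (f (\<mu> y))"
      using that power_mono_at[OF y f(1) g, of m n] ln_less[of "f (\<mu> y)" "g (\<mu> y)" m n]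
        ln_le[of "\<phi> f y" "\<phi> g y" m n] f gpos pgpos by simp
    show "real (Suc m) * - ln (\<phi> f y) \<le> real (Suc n) * - ln (\<phi> g y)"
      if "real (Suc m) * - ln (f (\<mu> y)) < real (Suc n) * - ln (g (\<mu> y))"
      using that power_mono_at[OF y g f(1), of n m] ln_less[of "g (\<mu> y)" "f (\<mu> y)" n m]
        ln_le[of "\<phi> g y" "\<phi> f y" n m] f gpos pgpos by simp
  qed
  then have "ln (\<phi> g y) = ln (\<phi> f y) / ln (f (\<mu> y)) * ln (g (\<mu> y))" by simp
  then show ?thesis using gpos pgpos by (metis exp_ln powr_def less_irrefl)
qed

lemma standard_pointsI:
  assumes y: "y \<in> topspace Y" and f: "f \<in> A" "0 < f (\<mu> y)" "f (\<mu> y) < 1" "0 < \<phi> f y" "\<phi> f y < 1"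
  shows "y \<in> standard_points X Y A \<phi>"
proof -
  have "0 < ln (\<phi> f y) / ln (f (\<mu> y))" using f by (simp add: divide_neg_neg)
  then show ?thesis
    using power_formula[OF y f] y mu_in[OF y] unfolding standard_points_def by blast
qed

text \<open>The point \<open>x\<close> of the definition must be \<open>\<mu> y\<close>: otherwise a
  bump at \<open>\<mu> y\<close> whose support misses \<open>x\<close> has image 1 at
  \<open>y\<close>, while \<open>0 powr p\<close> is 0.\<close>

lemma standard_pointsE:
  assumes "y \<in> standard_points X Y A \<phi>"
  obtains p where "0 < p" "\<And>f. f \<in> A \<Longrightarrow> \<phi> f y = f (\<mu> y) powr p"
proof -
  obtain p x where p: "0 < p" "x \<in> topspace X" "\<And>f. f \<in> A \<Longrightarrow> \<phi> f y = f x powr p"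
    and y: "y \<in> topspace Y"
    using assms by (auto simp: standard_points_def)
  have "x = \<mu> y"
  proof (rule ccontr)
    assume "x \<noteq> \<mu> y"
    then obtain f where f: "f \<in> A" "eventually (\<lambda>z. f z = 1) (nhdsin X (\<mu> y))" "x \<notin> supp X f"
      using X.separating_bump p(2) mu_in[OF y] by metis
    have "\<phi> f y = 1" using f near_one_iff[OF y] y eventually_nhdsin_imp by metis
    moreover have "f x = 0" using f(3) p(2) coz_subset_supp[of X f] by (auto simp: coz_def)
    ultimately show False using p(3)[OF f(1)] by simp
  qed
  with p that show ?thesis by blast
qed

section \<open>The exponent as a continuous function on the scale exp (- p)\<close>

text \<open>Where \<open>f\<close> can be used to read off the exponent:
  \<open>ln (f (\<mu> y))\<close> is then a genuine negative number. By Property 3 the windows cover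
  \<open>Y\<close>.\<close>

definition window :: "('a \<Rightarrow> real) \<Rightarrow> 'b set" where
  "window f = {y \<in> topspace Y. f (\<mu> y) \<in> {0<..<1}}"

text \<open>At a standard point with exponent \<open>p\<close> this is \<open>exp (- p)\<close>, whichever \<open>f\<close> is used; in this
  scale the exceptional exponents \<open>\<infinity>\<close> and \<open>0\<close> become the real values \<open>0\<close> and \<open>1\<close>.\<close>

definition local_base :: "('a \<Rightarrow> real) \<Rightarrow> 'b \<Rightarrow> real" where
  "local_base f y = \<phi> f y powr (- 1 / ln (f (\<mu> y)))"

lemma continuous_map_comp_mu: "f \<in> A \<Longrightarrow> continuous_map Y euclideanreal (\<lambda>y. f (\<mu> y))"
  using continuous_map_compose[OF continuous_map_mu X.continuous] by (simp add: o_def)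

lemma openin_window: "f \<in> A \<Longrightarrow> openin Y (window f)"
  unfolding window_def
  by (rule openin_continuous_map_preimage[OF continuous_map_comp_mu]) auto

lemma window_exists:
  assumes "y \<in> topspace Y"
  obtains f where "f \<in> A" "y \<in> window f"
  using X.value_between[OF mu_in[OF assms]] assms by (force simp: window_def)

lemma continuous_map_local_base:
  assumes "f \<in> A"
  shows "continuous_map (subtopology Y (window f)) euclideanreal (local_base f)"
  unfolding continuous_map_euclidean_iff_tendsto
proof
  let ?S = "subtopology Y (window f)"
  fix y assume y: "y \<in> topspace ?S"
  then have y': "y \<in> topspace Y" "0 < f (\<mu> y)" "f (\<mu> y) < 1" by (auto simp: window_def)
  have *: "(\<phi> f \<longlongrightarrow> \<phi> f y) (atin ?S y)" "((\<lambda>y. f (\<mu> y)) \<longlongrightarrow> f (\<mu> y)) (atin ?S y)"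
    using y continuous_map_from_subtopology[OF Y.continuous[OF maps[OF assms]], of "window f"]
      continuous_map_from_subtopology[OF continuous_map_comp_mu[OF assms], of "window f"]
    unfolding continuous_map_euclidean_iff_tendsto by blast+
  have nonneg: "eventually (\<lambda>y. 0 \<le> \<phi> f y) (atin ?S y)"
    using Y.nonneg[OF maps[OF assms]] y
    by (auto simp: eventually_atin intro!: exI[of _ "topspace ?S"])
  \<comment> \<open>A positive exponent keeps \<open>powr\<close> continuous even where the base
    \<open>\<phi> f y\<close> is 0.\<close>
  have "- 1 / ln (f (\<mu> y)) > 0" using y' by (simp add: divide_neg_neg)
  then show "(local_base f \<longlongrightarrow> local_base f y) (atin ?S y)"
    unfolding local_base_def using * nonneg y'
    by (intro tendsto_powr' tendsto_intros) auto
qed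

lemma local_base_standard:
  assumes "y \<in> window f" "f \<in> A" "\<And>f. f \<in> A \<Longrightarrow> \<phi> f y = f (\<mu> y) powr p"
  shows "local_base f y = exp (- p)"
  using assms(1) powr_times_minus_inverse_ln[of "f (\<mu> y)" p]
  by (simp add: local_base_def window_def assms(2,3))

lemma nonstandard_value:
  assumes "y \<in> window f" "f \<in> A" "y \<notin> standard_points X Y A \<phi>"
  shows "\<phi> f y = 0 \<or> \<phi> f y = 1"
proof -
  have "y \<in> topspace Y" using assms by (simp add: window_def)
  then show ?thesis
    using standard_pointsI[of y f] Y.nonneg[OF maps[OF assms(2)]] Y.le_one[OF maps[OF assms(2)]] assms
    by (force simp: window_def)
qed

text \<open>\<open>powr\<close> leaves the values 0 and 1 unchanged here, as its exponent is
  irrelevant at both bases.\<close>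

lemma local_base_nonstandard:
  assumes "y \<in> window f" "f \<in> A" "y \<notin> standard_points X Y A \<phi>"
  shows "local_base f y = \<phi> f y"
  using nonstandard_value[OF assms] by (auto simp: local_base_def)

text \<open>At a standard point both sides are exp (- p). Elsewhere both are 0 or 1, and the mixed
  case must be excluded.\<close>

lemma local_base_agree:
  assumes f: "f \<in> A" "y \<in> window f" and g: "g \<in> A" "y \<in> window g"
  shows "local_base f y = local_base g y"
proof (cases "y \<in> standard_points X Y A \<phi>")
  case True
  then obtain p where "\<And>f. f \<in> A \<Longrightarrow> \<phi> f y = f (\<mu> y) powr p"
    by (rule standard_pointsE) blast
  then show ?thesis using f g by (simp add: local_base_standard)
next
  case False
  \<comment> \<open>Some power of \<open>h\<close> is below \<open>k\<close> at
    \<open>\<mu> y\<close>, so a power of \<open>\<phi> h y\<close> bounds \<open>\<phi> k y\<close>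
    from below.\<close>
  have le: "\<phi> h y = 1 \<Longrightarrow> \<phi> k y \<noteq> 0" if h: "h \<in> A" "y \<in> window h" and k: "k \<in> A" "y \<in> window k" for h k
  proof -
    obtain m where "h (\<mu> y) ^ Suc m < k (\<mu> y)"
      using power_Suc_below[of "h (\<mu> y)" "k (\<mu> y)"] h k by (auto simp: window_def)
    then show "\<phi> h y = 1 \<Longrightarrow> \<phi> k y \<noteq> 0"
      using power_mono_at[of y h k m 0] h k by (auto simp: window_def)
  qed
  show ?thesis
    using le[OF f g] le[OF g f] nonstandard_value[OF f(2,1) False] nonstandard_value[OF g(2,1) False]
      local_base_nonstandard[OF f(2,1) False] local_base_nonstandard[OF g(2,1) False] by auto
qed

text \<open>Glues the local functions along the open cover by windows; by
  \<open>local_base_agree\<close> the choice of \<open>f\<close> does not matter.\<close>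

definition base :: "'b \<Rightarrow> real" where
  "base y = local_base (SOME f. f \<in> A \<and> y \<in> window f) y"

lemma base_eq:
  assumes "f \<in> A" "y \<in> window f"
  shows "base y = local_base f y"
proof -
  have "(SOME f. f \<in> A \<and> y \<in> window f) \<in> A \<and> y \<in> window (SOME f. f \<in> A \<and> y \<in> window f)"
    using assms by (intro someI[where P = "\<lambda>f. f \<in> A \<and> y \<in> window f"]) simp
  then show ?thesis unfolding base_def using assms by (intro local_base_agree) auto
qed

lemma continuous_map_base: "continuous_map Y euclideanreal base"
proof (rule pasting_lemma)
  show "openin Y (window f)" "continuous_map (subtopology Y (window f)) euclideanreal (local_base f)"
    if "f \<in> A" for f
    using that by (simp_all add: openin_window continuous_map_local_base)
  show "local_base f y = local_base g y"
    if "f \<in> A" "g \<in> A" "y \<in> topspace Y \<inter> window f \<inter> window g" for f g y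
    using that by (intro local_base_agree) auto
  show "\<exists>f. f \<in> A \<and> y \<in> window f \<and> base y = local_base f y" if "y \<in> topspace Y" for y
    using window_exists[OF that] base_eq by metis
qed

lemma base_standard:
  assumes "y \<in> standard_points X Y A \<phi>"
  shows "0 < base y" "base y < 1" "f \<in> A \<Longrightarrow> \<phi> f y = f (\<mu> y) powr (- ln (base y))"
proof -
  obtain p where p: "0 < p" "\<And>f. f \<in> A \<Longrightarrow> \<phi> f y = f (\<mu> y) powr p"
    using assms by (rule standard_pointsE) blast
  have "y \<in> topspace Y" using assms by (simp add: standard_points_def)
  then obtain g where "g \<in> A" "y \<in> window g" by (rule window_exists)
  then have "base y = exp (- p)" using p by (simp add: base_eq local_base_standard)
  then show "0 < base y" "base y < 1" "f \<in> A \<Longrightarrow> \<phi> f y = f (\<mu> y) powr (- ln (base y))"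
    using p by simp_all
qed

lemma base_nonstandard:
  assumes "y \<in> topspace Y" "y \<notin> standard_points X Y A \<phi>"
  shows "base y = 0 \<or> base y = 1"
proof -
  obtain f where f: "f \<in> A" "y \<in> window f" using assms(1) by (rule window_exists)
  then show ?thesis
    using nonstandard_value[OF f(2,1) assms(2)] local_base_nonstandard[OF f(2,1) assms(2)]
    by (simp add: base_eq)
qed

section \<open>Topology of the standard points and the extended exponent\<close>

lemma standard_points_subset: "standard_points X Y A \<phi> \<subseteq> topspace Y"
  by (auto simp: standard_points_def)

text \<open>If a window contained an open set without standard points, \<open>\<phi> f\<close> would be locally
  constant with value \<open>0\<close> or \<open>1\<close> there, and then so would be \<open>f\<close>.\<close>

lemma standard_points_dense: "Y closure_of (standard_points X Y A \<phi>) = topspace Y"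
proof (rule equalityI[OF closure_of_subset_topspace subsetI])
  fix y assume y: "y \<in> topspace Y"
  then obtain f where f: "f \<in> A" "y \<in> window f" by (rule window_exists)
  show "y \<in> Y closure_of (standard_points X Y A \<phi>)"
    unfolding in_closure_of
  proof (intro conjI allI impI y)
    fix U assume U: "y \<in> U \<and> openin Y U"
    show "\<exists>z. z \<in> standard_points X Y A \<phi> \<and> z \<in> U"
    proof (rule ccontr)
      assume contra: "\<not> (\<exists>z. z \<in> standard_points X Y A \<phi> \<and> z \<in> U)"
      have two: "\<phi> f z = 0 \<or> \<phi> f z = 1" if "z \<in> U" "z \<in> window f" for z
        using nonstandard_value that f(1) contra by blast
      have ev: "eventually (\<lambda>z. z \<in> U \<inter> window f) (nhdsin Y y)"
        unfolding eventually_nhdsin using U f openin_window[OF f(1)]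
        by (intro disjI2 exI[of _ "U \<inter> window f"]) auto
      have cont: "continuous_map Y euclideanreal (\<phi> f)" by (rule Y.continuous[OF maps[OF f(1)]])
      have x: "\<mu> y \<in> topspace X" using y by (rule mu_in)
      consider "\<phi> f y = 0" | "\<phi> f y = 1" using two[of y] U f by blast
      then show False
      proof cases
        case 1
        then have "eventually (\<lambda>z. \<phi> f z \<in> {..<1}) (nhdsin Y y)"
          by (intro continuous_map_eventually_nhdsin[OF cont _ y]) auto
        with ev have "eventually (\<lambda>z. \<phi> f z = 0) (nhdsin Y y)"
          by eventually_elim (use two in force)
        then have "f (\<mu> y) = 0"
          using near_zero_iff[OF y f(1)] eventually_nhdsin_imp x by metis
        then show False using f by (simp add: window_def)
      next
        case 2
        then have "eventually (\<lambda>z. \<phi> f z \<in> {0<..}) (nhdsin Y y)"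
          by (intro continuous_map_eventually_nhdsin[OF cont _ y]) auto
        with ev have "eventually (\<lambda>z. \<phi> f z = 1) (nhdsin Y y)"
          by eventually_elim (use two in force)
        then have "f (\<mu> y) = 1"
          using near_one_iff[OF y f(1)] eventually_nhdsin_imp x by metis
        then show False using f by (simp add: window_def)
      qed
    qed
  qed
qed

text \<open>\<open>base\<close> lies strictly between 0 and 1 at standard points and equals 0 or 1
  at all others, so this product vanishes exactly at the latter.\<close>

lemma cozero_set_standard_points: "cozero_set Y (standard_points X Y A \<phi>)"
  unfolding cozero_set_def
proof (intro exI conjI)
  show "continuous_map Y euclideanreal (\<lambda>y. base y * (1 - base y))"
    by (intro continuous_map_real_mult continuous_map_diff continuous_map_base) simp
  show "standard_points X Y A \<phi> = coz Y (\<lambda>y. base y * (1 - base y))"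
    using base_standard(1,2) base_nonstandard standard_points_subset by (fastforce simp: coz_def)
qed

lemma continuous_map_exponent:
  "continuous_map (subtopology Y (standard_points X Y A \<phi>)) (top_of_set {0<..}) (\<lambda>y. - ln (base y))"
proof -
  let ?S = "subtopology Y (standard_points X Y A \<phi>)"
  have "continuous_map ?S euclideanreal base"
    by (rule continuous_map_from_subtopology[OF continuous_map_base])
  then have "continuous_map ?S euclideanreal (\<lambda>y. - ln (base y))"
    unfolding continuous_map_euclidean_iff_tendsto
    using base_standard(1) by (force intro!: tendsto_intros)
  then show ?thesis using base_standard(1,2) by (auto simp: continuous_map_in_subtopology)
qed

lemma continuous_map_extended_exponent:
  "continuous_map Y euclidean (\<lambda>y. ext_neg_ln (base y))"
proof -
  have "base y \<in> {0..}" if "y \<in> topspace Y" for y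
    using base_standard(1)[of y] base_nonstandard[OF that] by fastforce
  then have "continuous_map Y (top_of_set {0..}) base"
    using continuous_map_base by (auto simp: continuous_map_in_subtopology)
  moreover have "continuous_map (top_of_set {0..}) euclidean ext_neg_ln"
    using continuous_on_ext_neg_ln by simp
  ultimately show ?thesis
    using continuous_map_compose[of Y _ base euclidean ext_neg_ln] by (simp add: o_def)
qed

end

theorem theorem2p1:
  fixes X :: "'a topology" and Y :: "'b topology"
    and A :: "('a \<Rightarrow> real) set" and B :: "('b \<Rightarrow> real) set"
    and \<phi> :: "('a \<Rightarrow> real) \<Rightarrow> ('b \<Rightarrow> real)"
  assumes "compact_space X" and "Hausdorff_space X"
    and "compact_space Y" and "Hausdorff_space Y"
    and "mult_semigroup X A" and "property1 X A" and "property2 X A" and "property3 X A"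
    and "mult_semigroup Y B" and "property1 Y B" and "property2 Y B" and "property3 Y B"
    and "multiplicative_on X Y A \<phi>" and "bij_betw \<phi> A B"
  shows "\<exists>(\<mu> :: 'b \<Rightarrow> 'a) (p :: 'b \<Rightarrow> real).
      homeomorphic_map Y X \<mu> \<and>
      continuous_map (subtopology Y (standard_points X Y A \<phi>)) (top_of_set {0<..}) p \<and>
      (\<forall>f\<in>A. \<forall>y\<in>standard_points X Y A \<phi>. \<phi> f y = f (\<mu> y) powr p y) \<and>
      Y closure_of (standard_points X Y A \<phi>) = topspace Y \<and>
      cozero_set Y (standard_points X Y A \<phi>) \<and>
      (\<exists>q :: 'b \<Rightarrow> ennreal.
         continuous_map Y euclidean q \<and>
         (\<forall>y\<in>standard_points X Y A \<phi>. q y = ennreal (p y)) \<and>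
         (\<forall>y\<in>topspace Y - standard_points X Y A \<phi>. q y \<in> {0, \<infinity>}))"
proof -
  interpret semigroup_iso X A Y B \<phi>
    using assms by unfold_locales
  have "ext_neg_ln (base y) = ennreal (- ln (base y))" if "y \<in> standard_points X Y A \<phi>" for y
    using base_standard(1)[OF that] by (simp add: ext_neg_ln_def)
  \<comment> \<open>The value 0 of \<open>base\<close> gives exponent \<infinity>, and the value 1
    gives exponent 0.\<close>
  moreover have "ext_neg_ln (base y) \<in> {0, \<infinity>}" if "y \<in> topspace Y - standard_points X Y A \<phi>" for y
    using base_nonstandard[of y] that by (auto simp: ext_neg_ln_def)
  ultimately show ?thesis
    using homeomorphic_map_mu continuous_map_exponent base_standard(3) standard_points_dense
      cozero_set_standard_points continuous_map_extended_exponent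
    by (intro exI[of _ \<mu>] exI[of _ "\<lambda>y. - ln (base y)"] conjI exI[of _ "\<lambda>y. ext_neg_ln (base y)"])
      auto
qed

end
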